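(* Let $L$ be a field of characteristic $p$, let $\alpha,\beta\in L$, let $d\ge 2$ be an integer, and for $\lambda\in\overline{L}$ let $f_\lambda(z)=z^d+\lambda$. Then there exist infinitely many $\lambda\in\overline{L}$ such that $f_\lambda^m(\alpha)=\beta$ for some $m\in\mathbb{N}$ (where $m$ may depend on $\lambda$).
   Context: $\mathbb{N}$ denotes the set of positive integers. $\overline{L}$ is a fixed algebraic closure of $L$. $f_\lambda^m$ denotes the $m$-th compositional iterate of $f_\lambda$. *)

theory Defs
  imports "HOL-Algebra.Algebraic_Closure_Type" "HOL-Computational_Algebra.Primes"
begin

definition unicritical :: "nat \<Rightarrow> 'a::field \<Rightarrow> 'a \<Rightarrow> 'a" where
  "unicritical d lam z = z ^ d + lam"

end

(* Regard the m-th iterate of \<alpha> minus \<beta> as a polynomial P_m in \<lambda>; it is monic of degree d^(m-1).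
   Suppose that all the P_m together have only K roots.  If \<lambda> is a root of both P_m and P_(m+j) of
   multiplicity > B, then (z - w divides h(z) - h(w)) it is also a root of multiplicity > B of the
   polynomial f_\<lambda>^j(\<beta>) - \<beta>, whose degree is d^(j-1).  So for B = d^K and K + 1 consecutive indices m, each
   root has multiplicity > B for at most one m of them, hence some P_m in this window has no root
   of multiplicity > B.  Its degree d^(m-1) is then at most K B, which fails for large m. *)
theory Submission
  imports Defs
begin

text \<open>Here \<open>[:0, 1:]\<close> is the parameter lambda, kept as an indeterminate, so
  iterating from \<open>[:a:]\<close> yields the iterates of \<open>a\<close> as polynomials in
  lambda.\<close>

definition param_step :: "nat \<Rightarrow> 'a::comm_ring_1 poly \<Rightarrow> 'a poly" where
  "param_step d u = u ^ d + [:0, 1:]"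

lemma poly_param_step_funpow:
  "poly ((param_step d ^^ m) u) x = (unicritical d x ^^ m) (poly u x)"
  for x :: "'a::field"
  by (induction m) (simp_all add: param_step_def unicritical_def)

text \<open>The first step makes a constant linear. From then on \<open>u ^ d\<close> has degree at
  least 2 and dominates the added indeterminate.\<close>

lemma degree_param_step_funpow:
  fixes a :: "'a::idom"
  assumes "d \<ge> 2"
  shows "degree ((param_step d ^^ Suc m) [:a:]) = d ^ m"
proof (induction m)
  case 0
  have "[:a:] ^ d = [:a ^ d:]" by (induction d) auto
  then show ?case by (simp add: param_step_def)
next
  case (Suc m)
  define u where "u = (param_step d ^^ Suc m) [:a:]"
  have u: "degree u = d ^ m" using Suc by (simp add: u_def)
  have "d ^ Suc m > 1" using assms by (simp only: one_less_power)
  moreover have "u \<noteq> 0" using u assms by (metis degree_0 power_not_zero not_numeral_le_zero)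
  ultimately have "degree (u ^ d) = d ^ Suc m" using u by (simp add: degree_power_eq)
  then have "degree (u ^ d + [:0, 1:]) = d ^ Suc m"
    using \<open>d ^ Suc m > 1\<close> by (subst degree_add_eq_left) auto
  then show ?case by (simp add: u_def flip: param_step_def)
qed

definition hit_poly :: "nat \<Rightarrow> 'a::comm_ring_1 \<Rightarrow> 'a \<Rightarrow> nat \<Rightarrow> 'a poly" where
  "hit_poly d a b m = (param_step d ^^ m) [:a:] - [:b:]"

lemma degree_hit_poly:
  fixes a b :: "'a::idom"
  assumes "d \<ge> 2"
  shows "degree (hit_poly d a b (Suc m)) = d ^ m"
proof -
  have "degree ((param_step d ^^ Suc m) [:a:] + [:-b:]) = d ^ m"
    using degree_param_step_funpow[OF assms, of m a] assms by (subst degree_add_eq_left) auto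
  then show ?thesis by (simp add: hit_poly_def diff_conv_add_uminus del: add_uminus_conv_diff)
qed

lemma hit_poly_nonzero:
  fixes a b :: "'a::idom"
  assumes "d \<ge> 2"
  shows "hit_poly d a b (Suc m) \<noteq> 0"
  using degree_hit_poly[OF assms, of a b m] assms by auto

lemma poly_hit_poly_eq_0_iff:
  "poly (hit_poly d a b m) x = 0 \<longleftrightarrow> (unicritical d x ^^ m) a = b"
  for x :: "'a::field"
  by (simp add: hit_poly_def poly_param_step_funpow)

text \<open>The added indeterminate cancels in a difference, and x - y divides x^d - y^d.\<close>

lemma diff_dvd_param_step_funpow_diff:
  "u - v dvd (param_step d ^^ j) u - (param_step d ^^ j) v"
proof (induction j)
  case (Suc j)
  let ?x = "(param_step d ^^ j) u" and ?y = "(param_step d ^^ j) v"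
  have "?x - ?y dvd ?x ^ d - ?y ^ d" by (simp add: power_diff_sumr2)
  with Suc have "u - v dvd ?x ^ d - ?y ^ d" by (rule dvd_trans)
  then show ?case by (simp add: param_step_def[of d ?x] param_step_def[of d ?y])
qed simp

text \<open>Modulo \<open>q\<close> the orbit of \<open>a\<close> is at \<open>b\<close> at time
  \<open>m\<close>, hence at the \<open>j\<close>-th iterate of \<open>b\<close> at time
  \<open>m + j\<close>; but there it is at \<open>b\<close> again.\<close>

lemma dvd_hit_poly_add:
  assumes "q dvd hit_poly d a b m" "q dvd hit_poly d a b (m + j)"
  shows "q dvd hit_poly d b b j"
proof -
  let ?F = "\<lambda>n x. (param_step d ^^ n) [:x:]"
  have "q dvd ?F (m + j) a - ?F j b"
    using dvd_trans[OF assms(1)[unfolded hit_poly_def] diff_dvd_param_step_funpow_diff[where d = d and j = j]]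
    by (simp add: add.commute[of m] funpow_add)
  with assms(2) have "q dvd (?F (m + j) a - [:b:]) - (?F (m + j) a - ?F j b)"
    unfolding hit_poly_def by (rule dvd_diff)
  then show ?thesis by (simp add: hit_poly_def del: minus_pCons)
qed

text \<open>The gap is written \<open>Suc j\<close> because \<open>hit_poly d b b 0\<close> is zero
  and would bound no order.\<close>

lemma min_order_hit_poly_le:
  fixes a b s :: "'a::idom"
  assumes "d \<ge> 2"
  shows "min (order s (hit_poly d a b m)) (order s (hit_poly d a b (m + Suc j))) \<le> d ^ j"
proof -
  let ?n = "min (order s (hit_poly d a b m)) (order s (hit_poly d a b (m + Suc j)))"
  have "[:-s, 1:] ^ ?n dvd hit_poly d b b (Suc j)"
    by (rule dvd_hit_poly_add[of _ d a b m]) (simp_all only: order_divides min.cobounded1 min.cobounded2 simp_thms)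
  then have "?n \<le> order s (hit_poly d b b (Suc j))"
    using hit_poly_nonzero[OF assms, of b b j] by (simp add: order_divides)
  also have "\<dots> \<le> d ^ j"
    using order_degree[OF hit_poly_nonzero[OF assms]] degree_hit_poly[OF assms] by metis
  finally show ?thesis .
qed

text \<open>A nonzero polynomial splits into linear factors; for zero both sides are 0 by
  convention.\<close>

lemma size_proots_eq_degree:
  fixes p :: "'a::alg_closed_field poly"
  shows "size (proots p) = degree p"
proof (cases "p = 0")
  case False
  then obtain A where A: "size A = degree p" "p = smult (lead_coeff p) (\<Prod>x\<in>#A. [:-x, 1:])"
    using alg_closed_imp_factorization by blast
  have "proots (\<Prod>x\<in>#A. [:-x, 1:]) = A"
    by (induction A) (auto simp: proots_mult image_iff simp del: mult_pCons_left)
  with A False show ?thesis by (metis leading_coeff_0_iff proots_smult)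
qed simp

lemma degree_eq_sum_order:
  fixes p :: "'a::alg_closed_field poly"
  assumes "p \<noteq> 0"
  shows "degree p = (\<Sum>x | poly p x = 0. order x p)"
  using assms by (simp flip: size_proots_eq_degree add: size_multiset_overloaded_eq)

theorem infinite_unicritical_hitting_parameters:
  fixes a b :: "'a::alg_closed_field"
  assumes d: "d \<ge> 2"
  shows "infinite {x. \<exists>m\<ge>1. (unicritical d x ^^ m) a = b}" (is "infinite ?S")
proof
  define S where "S = ?S"
  assume "finite ?S"
  then have fin: "finite S" by (simp add: S_def)
  let ?P = "hit_poly d a b"
  define K where "K = card S"
  \<comment> \<open>A window of K + 1 indices beats the K elements of \<open>S\<close> in the
    pigeonhole argument. It starts above \<open>K * d ^ K\<close>, so that m - 1 is at least the
    final bound on the degree.\<close>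
  define W where "W = {K * d ^ K + 1..K * d ^ K + 1 + K}"
  have roots: "{x. poly (?P m) x = 0} \<subseteq> S" if "m \<in> W" for m
    using that by (auto simp: S_def W_def poly_hit_poly_eq_0_iff intro!: exI[of _ m])
  have "\<exists>m\<in>W. \<forall>s\<in>S. order s (?P m) \<le> d ^ K"
  proof (rule ccontr)
    assume "\<not> ?thesis"
    then have "\<forall>m\<in>W. \<exists>s. s \<in> S \<and> order s (?P m) > d ^ K" by (meson not_le)
    then obtain g where g: "\<And>m. m \<in> W \<Longrightarrow> g m \<in> S \<and> order (g m) (?P m) > d ^ K"
      by metis
    \<comment> \<open>Two indices of the window share a point of order above \<open>d ^ K\<close>,
      yet they differ by at most K.\<close>
    have "card (g ` W) \<le> card S" using g by (intro card_mono fin) blast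
    also have "\<dots> < card W" by (simp add: K_def W_def)
    finally have "\<not> inj_on g W" by (rule pigeonhole)
    then obtain m m' where m: "m \<in> W" "m' \<in> W" "g m = g m'" "m < m'"
      unfolding inj_on_def by (metis linorder_neqE_nat)
    then obtain j where j: "m' = m + Suc j" using less_imp_Suc_add by auto
    with m have "j \<le> K" by (auto simp: W_def)
    with d have "d ^ j \<le> d ^ K" by (intro power_increasing) auto
    with min_order_hit_poly_le[OF d, of "g m" a b m j] g[of m] g[of m'] m j
    show False by (auto simp: min_le_iff_disj)
  qed
  then obtain m where m: "m \<in> W" "\<And>s. s \<in> S \<Longrightarrow> order s (?P m) \<le> d ^ K" by blast
  then obtain n where n: "m = Suc n" "K * d ^ K \<le> n" by (cases m) (auto simp: W_def)
  \<comment> \<open>Counting roots with multiplicity gives d^n \<le> K d^K \<le> n, against n < 2^n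
    \<le> d^n.\<close>
  have "d ^ n = (\<Sum>x | poly (?P m) x = 0. order x (?P m))"
    using degree_eq_sum_order[OF hit_poly_nonzero[OF d]] degree_hit_poly[OF d] n by metis
  also have "\<dots> \<le> (\<Sum>x\<in>S. order x (?P m))"
    by (rule sum_mono2[OF fin roots[OF m(1)]]) simp
  also have "\<dots> \<le> card S * d ^ K" using sum_bounded_above[of S] m(2) by (metis of_nat_id)
  also have "\<dots> \<le> n" using n by (simp add: K_def)
  also have "n < 2 ^ n" by (rule less_exp)
  also have "\<dots> \<le> d ^ n" using d by (rule power_mono) simp
  finally show False by simp
qed

theorem theorem2p4:
  fixes \<alpha> \<beta> :: "'l::field" and p d :: nat
  assumes "Factorial_Ring.prime p" and "CHAR('l) = p" and "d \<ge> 2"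
  shows "infinite {lam :: 'l alg_closure.
           \<exists>m::nat. m \<ge> 1 \<and> (unicritical d lam ^^ m) (to_ac \<alpha>) = to_ac \<beta>}"
  using assms(3) by (rule infinite_unicritical_hitting_parameters)

end
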